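(* Fix any $D\in\mathbb{R}^{m\times p}$ and $\lambda>0$. Assume that the joint distribution of $(X,y)$, with $X\in\mathbb{R}^{n\times p}$ and $y\in\mathbb{R}^n$, is absolutely continuous with respect to $(np+n)$-dimensional Lebesgue measure. If $p\le n$, or else $p>n$ and $\mathrm{nullity}(D)\le n$, then the solution in the generalized lasso problem $$\min_{\beta\in\mathbb{R}^p}\ \tfrac12\|y-X\beta\|_2^2+\lambda\|D\beta\|_1$$ is unique almost surely.
   Context: $\mathrm{nullity}(D)$ denotes the dimension of the null space of $D$. *)

theory Defs
  imports "HOL-Probability.Probability"
begin

definition l1_norm :: "real ^ 'm \<Rightarrow> real" where
  "l1_norm v = (\<Sum>i\<in>UNIV. \<bar>v $ i\<bar>)"

definition nullity :: "real ^ 'p ^ 'm \<Rightarrow> nat" where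
  "nullity D = dim {\<beta>. D *v \<beta> = 0}"

definition gen_lasso_objective ::
  "real ^ 'n \<Rightarrow> real ^ 'p ^ 'n \<Rightarrow> real ^ 'p ^ 'm \<Rightarrow> real \<Rightarrow> real ^ 'p \<Rightarrow> real" where
  "gen_lasso_objective y X D lam \<beta> =
     1 / 2 * (norm (y - X *v \<beta>))\<^sup>2 + lam * l1_norm (D *v \<beta>)"

definition gen_lasso_solution ::
  "real ^ 'n \<Rightarrow> real ^ 'p ^ 'n \<Rightarrow> real ^ 'p ^ 'm \<Rightarrow> real \<Rightarrow> real ^ 'p \<Rightarrow> bool" where
  "gen_lasso_solution y X D lam \<beta> \<longleftrightarrow>
     is_arg_min (gen_lasso_objective y X D lam) (\<lambda>_. True) \<beta>"

end

theory Submission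
  imports Defs
begin

text \<open>
  For almost every \<open>X\<close>, each of the finitely many subspaces \<open>face D s\<close> (the span of the cell on which
  \<open>D \<beta>\<close> has sign pattern \<open>s\<close>) and its subspace \<open>s \<bullet> (D *v u) = 0\<close> is mapped by \<open>X\<close> injectively if
  its dimension is at most \<open>n\<close> and onto \<open>\<real>\<^sup>n\<close> if it is at least \<open>n\<close>.
  If there were two solutions, let \<open>s\<close> be the sign pattern at their midpoint
  \<open>\<beta>\<close>. Their difference lies in \<open>face D s\<close> and in the kernel of
  \<open>X\<close>, so that \<open>dim (face D s) > n\<close>, and \<open>X\<close> maps even that
  subspace onto \<open>\<real>\<^sup>n\<close>. The objective is smooth at \<open>\<beta>\<close>
  along \<open>face D s\<close>, where stationarity reads \<open>(y - X *v \<beta>) \<bullet> (X *v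
  u) = lam * (s \<bullet> (D *v u))\<close>. Hence the right-hand side vanishes on the whole face,
  the residual is 0, and so is \<open>D *v \<beta>\<close> because \<open>s \<bullet> (D *v \<beta>)
  = l1_norm (D *v \<beta>)\<close>. Then both solutions lie in the null space of \<open>D\<close>,
  on which \<open>X\<close> is injective because its dimension is at most \<open>n\<close>.
\<close>

section \<open>Null sets and generic matrices\<close>

text \<open>By Fubini the two almost-everywhere quantifiers can be exchanged, so some single
  translate of \<open>N\<close> is null; translation invariance of Lebesgue measure carries this
  back to \<open>N\<close>.\<close>

lemma AE_lborel_not_in_by_shift:
  fixes N :: "'a::euclidean_space set" and f :: "'b::euclidean_space \<Rightarrow> 'a"
  assumes f [measurable]: "f \<in> borel_measurable borel" and N: "N \<in> sets borel"
    and shift: "\<And>x. AE w in lborel. x + f w \<notin> N"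
  shows "AE x in lborel. x \<notin> N"
proof -
  have [measurable]: "N \<in> sets lborel"
    using N by simp
  have "{p \<in> space (lborel \<Otimes>\<^sub>M lborel). fst p + f (snd p) \<notin> N} \<in> sets (lborel \<Otimes>\<^sub>M lborel)"
    by measurable
  then have "AE w in lborel. AE x in lborel. x + f w \<notin> N"
    by (subst lborel_pair.AE_commute [symmetric]) (use shift in auto)
  moreover have "ae_filter (lborel :: 'b measure) \<noteq> bot"
    by (simp add: ae_filter_eq_bot_iff)
  ultimately obtain w where "AE x in lborel. x + f w \<notin> N"
    using eventually_happens' by blast
  then have "AE x in lborel. f w + x \<notin> N"
    by (simp add: add.commute)
  moreover have "(AE x in distr lborel borel ((+) (f w)). x \<notin> N) \<longleftrightarrow>
      (AE x in lborel. f w + x \<notin> N)"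
    by (rule AE_distr_iff) measurable
  ultimately show ?thesis
    by (simp only: lborel_distr_plus)
qed

lemma negligible_imp_AE_lborel:
  assumes "negligible S"
  shows "AE x in lborel. x \<notin> S"
proof -
  have "AE x in lebesgue. x \<notin> S"
    using assms by (auto simp: negligible_iff_null_sets intro: AE_not_in)
  then show ?thesis
    by (simp add: AE_completion_iff)
qed

definition outer_product :: "real ^ 'n \<Rightarrow> real ^ 'p \<Rightarrow> real ^ 'p ^ 'n" where
  "outer_product w u = (\<chi> i j. w $ i * u $ j)"

lemma outer_product_mult_vec: "outer_product w u *v v = (u \<bullet> v) *\<^sub>R w"
  by (simp add: vec_eq_iff outer_product_def matrix_vector_mult_def inner_vec_def
      sum_distrib_left sum_distrib_right mult_ac)

lemma borel_measurable_outer_product [measurable]: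
  "(\<lambda>w. outer_product w u) \<in> borel_measurable borel"
  unfolding outer_product_def
  by (intro borel_measurable_continuous_onI continuous_on_vec_lambda continuous_intros)

text \<open>Scaling moves a kernel vector onto the unit sphere of \<open>U\<close>, which is
  compact, and projecting a closed set along a compact factor gives a closed set. The purpose is
  Borel measurability of the exceptional sets.\<close>

lemma closed_kernel_meets_subspace:
  fixes U :: "(real ^ 'p) set"
  assumes "subspace U"
  shows "closed {X :: real ^ 'p ^ 'n. \<exists>v\<in>U. X *v v = 0 \<and> v \<noteq> 0}"
proof -
  have "continuous_on UNIV (\<lambda>p :: (real ^ 'p) \<times> (real ^ 'p ^ 'n). snd p *v fst p)"
    unfolding matrix_vector_mult_def
    by (intro continuous_on_vec_lambda continuous_intros)
  then have "closed ((\<lambda>p :: (real ^ 'p) \<times> (real ^ 'p ^ 'n). snd p *v fst p) -` {0})"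
    by (intro continuous_closed_vimage) (auto simp: continuous_on_eq_continuous_at)
  moreover have "compact (sphere 0 1 \<inter> U)"
    using assms by (intro compact_Int_closed compact_sphere closed_subspace)
  ultimately have "closed {X. \<exists>v. v \<in> sphere 0 1 \<inter> U \<and>
      (v, X) \<in> (\<lambda>p :: (real ^ 'p) \<times> (real ^ 'p ^ 'n). snd p *v fst p) -` {0}}"
    by (rule closed_compact_projection [rotated])
  also have "{X. \<exists>v. v \<in> sphere 0 1 \<inter> U \<and>
      (v, X) \<in> (\<lambda>p :: (real ^ 'p) \<times> (real ^ 'p ^ 'n). snd p *v fst p) -` {0}} =
      {X. \<exists>v\<in>U. X *v v = 0 \<and> v \<noteq> 0}" (is "?A = ?B")
  proof (intro equalityI subsetI)
    fix X assume "X \<in> ?B"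
    then obtain v where v: "v \<in> U" "X *v v = 0" "v \<noteq> 0"
      by auto
    then have "(1 / norm v) *\<^sub>R v \<in> sphere 0 1 \<inter> U" "X *v ((1 / norm v) *\<^sub>R v) = 0"
      using assms by (auto simp: subspace_scale matrix_vector_mult_scaleR)
    then show "X \<in> ?A"
      by (intro CollectI exI [of _ "(1 / norm v) *\<^sub>R v"] conjI) simp_all
  qed auto
  finally show ?thesis .
qed

text \<open>Induction over \<open>B\<close>: the shifts \<open>w\<close> that spoil injectivity in
  the new direction \<open>u\<close> lie in a translate of the image of \<open>span B\<close>, whose
  dimension is less than \<open>CARD('n)\<close>. Orthogonality provides the functional
  \<open>a\<close>, which is 1 at \<open>u\<close> and 0 on \<open>span B\<close>.\<close>

lemma AE_inj_on_span:
  fixes B :: "(real ^ 'p) set"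
  assumes "finite B" "pairwise orthogonal B" "0 \<notin> B" "card B \<le> CARD('n)"
  shows "AE X :: real ^ 'p ^ 'n in lborel. \<forall>v\<in>span B. X *v v = 0 \<longrightarrow> v = 0"
  using assms
proof (induction B rule: finite_induct)
  case empty
  then show ?case by simp
next
  case (insert u B)
  define N where "N U = {X :: real ^ 'p ^ 'n. \<exists>v\<in>U. X *v v = 0 \<and> v \<noteq> 0}" for U
  have "u \<noteq> 0" and orth: "\<And>v. v \<in> span B \<Longrightarrow> u \<bullet> v = 0"
    using insert by (auto simp: pairwise_insert orthogonal_to_span orthogonal_def
      intro: orthogonal_to_span[unfolded orthogonal_def])
  define a where "a = (1 / (u \<bullet> u)) *\<^sub>R u"
  have a: "a \<bullet> u = 1" "\<And>v. v \<in> span B \<Longrightarrow> a \<bullet> v = 0"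
    using \<open>u \<noteq> 0\<close> orth by (auto simp: a_def)
  have IH: "AE X in lborel. X \<notin> N (span B)"
    using insert by (auto simp: N_def pairwise_insert)
  \<comment> \<open>Adding \<open>outer_product w a\<close> to \<open>X\<close> leaves \<open>X\<close> unchanged on \<open>span B\<close> and shifts \<open>X *v u\<close> by \<open>w\<close>.\<close>
  have "AE X in lborel. X \<notin> N (span (insert u B)) - N (span B)"
  proof (rule AE_lborel_not_in_by_shift [where f = "\<lambda>w. outer_product w a"])
    show "N (span (insert u B)) - N (span B) \<in> sets borel"
      unfolding N_def by (intro sets.Diff borel_closed closed_kernel_meets_subspace subspace_span)
    fix X :: "real ^ 'p ^ 'n"
    have "dim ((*v) X ` span B) \<le> card B"
      using dim_image_le [of "(*v) X" "span B"] insert.hyps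
      by (simp add: dim_le_card' le_trans)
    then have "dim ((*v) X ` span B) < DIM(real ^ 'n)"
      using insert by simp
    then have "negligible ((+) (- (X *v u)) ` (*v) X ` span B)"
      by (intro negligible_translation negligible_lowdim)
    then have avoid: "AE w in lborel. w \<notin> (+) (- (X *v u)) ` (*v) X ` span B"
      by (rule negligible_imp_AE_lborel)
    \<comment> \<open>Removing \<open>N (span B)\<close> forces the coefficient \<open>t\<close> of
      \<open>u\<close> in a kernel vector to be nonzero, so the kernel equation can be solved for
      \<open>w\<close>.\<close>
    have hit: "w \<in> (+) (- (X *v u)) ` (*v) X ` span B"
      if w: "X + outer_product w a \<in> N (span (insert u B)) - N (span B)" for w
    proof -
      obtain v where v: "v \<in> span (insert u B)" "(X + outer_product w a) *v v = 0" "v \<noteq> 0"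
        using w by (auto simp: N_def)
      then obtain t where t: "v - t *\<^sub>R u \<in> span B"
        by (auto simp: span_insert)
      define z where "z = v - t *\<^sub>R u"
      have veq: "v = z + t *\<^sub>R u" and z: "z \<in> span B"
        using t by (auto simp: z_def)
      have "t \<noteq> 0"
        using w v z veq by (auto simp: N_def)
      have "X *v z + t *\<^sub>R (X *v u + w) = 0"
        using v(2) a z
        by (simp add: veq matrix_vector_mult_add_rdistrib outer_product_mult_vec
            matrix_vector_right_distrib matrix_vector_mult_scaleR inner_add_right scaleR_add_right)
      then have "(1 / t) *\<^sub>R (X *v z + t *\<^sub>R (X *v u + w)) = 0"
        by simp
      then have "w = - (X *v u) + (- 1 / t) *\<^sub>R (X *v z)"
        using \<open>t \<noteq> 0\<close> by (simp add: scaleR_add_right) (simp add: algebra_simps eq_neg_iff_add_eq_0)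
      also have "(- 1 / t) *\<^sub>R (X *v z) = X *v ((- 1 / t) *\<^sub>R z)"
        by (simp only: matrix_vector_mult_scaleR)
      finally show ?thesis
        using z by (blast intro: span_scale)
    qed
    show "AE w in lborel. X + outer_product w a \<notin> N (span (insert u B)) - N (span B)"
      using avoid by (rule eventually_mono) (use hit in blast)
  qed measurable
  with IH have "AE X in lborel. X \<notin> N (span (insert u B))"
    by eventually_elim auto
  then show ?case
    by eventually_elim (auto simp: N_def)
qed

text \<open>For a subspace \<open>U\<close> this says that the restriction of \<open>X\<close> to
  \<open>U\<close> has the largest possible rank.\<close>

definition general_position :: "real ^ 'p ^ 'n \<Rightarrow> (real ^ 'p) set \<Rightarrow> bool" where
  "general_position X U \<longleftrightarrow>
     (dim U \<le> CARD('n) \<longrightarrow> (\<forall>v\<in>U. X *v v = 0 \<longrightarrow> v = 0)) \<and>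
     (CARD('n) \<le> dim U \<longrightarrow> (*v) X ` U = UNIV)"

text \<open>Injectivity on \<open>span C\<close>, for a part \<open>C\<close> of an orthogonal
  basis, serves both cases: \<open>C\<close> is the whole basis if \<open>dim U\<close> is at most
  \<open>CARD('n)\<close>, and otherwise the image of \<open>span C\<close> already has full
  dimension.\<close>

lemma AE_general_position:
  fixes U :: "(real ^ 'p) set"
  assumes "subspace U"
  shows "AE X :: real ^ 'p ^ 'n in lborel. general_position X U"
proof -
  obtain B where B: "0 \<notin> B" "B \<subseteq> U" "pairwise orthogonal B" "independent B" "card B = dim U" "span B = U"
    using orthogonal_basis_subspace [OF assms] by (metis dependent_zero)
  obtain C where C: "C \<subseteq> B" "card C = min (dim U) CARD('n)" "finite C"
    using obtain_subset_with_card_n [of "min (dim U) CARD('n)" B] B(5) by auto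
  have dimC: "dim (span C) = card C"
    using B(4) C(1) by (metis dim_span_eq_card_independent independent_mono)
  have "AE X :: real ^ 'p ^ 'n in lborel. \<forall>v\<in>span C. X *v v = 0 \<longrightarrow> v = 0"
    using B C by (intro AE_inj_on_span) (auto intro: pairwise_subset)
  then show ?thesis
  proof eventually_elim
    case (elim X)
    have "\<forall>v\<in>U. X *v v = 0 \<longrightarrow> v = 0" if "dim U \<le> CARD('n)"
    proof -
      have "C = B"
        using C B that by (metis card_subset_eq independent_imp_finite min.absorb1)
      then show ?thesis
        using elim B(6) by simp
    qed
    moreover have "(*v) X ` U = UNIV" if "CARD('n) \<le> dim U"
    proof -
      have "inj_on ((*v) X) (span C)"
        using elim by (subst linear_injective_on_subspace_0) auto
      then have "dim ((*v) X ` span C) = dim (span C)"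
        by (intro dim_image_eq) (auto simp: span_span)
      then have "dim ((*v) X ` span C) = DIM(real ^ 'n)"
        using that dimC C(2) by simp
      then have "span ((*v) X ` span C) = UNIV"
        by (metis dim_eq_full)
      then have "(*v) X ` span C = UNIV"
        by (metis linear_subspace_image matrix_vector_mul_linear span_eq_iff subspace_span)
      moreover have "span C \<subseteq> U"
        using C(1) B(6) span_mono by blast
      ultimately show ?thesis
        by blast
    qed
    ultimately show ?case
      by (simp add: general_position_def)
  qed
qed

section \<open>Sign vectors and the local form of the l1 norm\<close>

text \<open>The library's \<open>sgn\<close> on vectors normalizes to length 1, hence a componentwise version.\<close>

definition sign_vec :: "real ^ 'm \<Rightarrow> real ^ 'm" where
  "sign_vec a = (\<chi> i. sgn (a $ i))"

lemma inner_sign_vec_self: "sign_vec a \<bullet> a = l1_norm a"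
  by (simp add: sign_vec_def inner_vec_def l1_norm_def mult.commute flip: abs_sgn)

lemma finite_range_sign_vec: "finite (range (sign_vec :: real ^ 'm \<Rightarrow> real ^ 'm))"
proof (rule finite_subset)
  show "range (sign_vec :: real ^ 'm \<Rightarrow> real ^ 'm) \<subseteq> vec_lambda ` (UNIV \<rightarrow>\<^sub>E {-1, 0, 1})"
  proof
    fix s :: "real ^ 'm" assume "s \<in> range sign_vec"
    then have "s = vec_lambda (vec_nth s)" "vec_nth s \<in> UNIV \<rightarrow>\<^sub>E {-1, 0, 1}"
      by (auto simp: sign_vec_def sgn_real_def split: if_splits)
    then show "s \<in> vec_lambda ` (UNIV \<rightarrow>\<^sub>E {-1, 0, 1})"
      by blast
  qed
  show "finite (vec_lambda ` (UNIV \<rightarrow>\<^sub>E {-1, 0, 1 :: real}) :: (real ^ 'm) set)"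
    by (intro finite_imageI finite_PiE) auto
qed

lemma l1_norm_nonneg: "0 \<le> l1_norm a"
  by (simp add: l1_norm_def sum_nonneg)

lemma l1_norm_eq_0_iff: "l1_norm a = 0 \<longleftrightarrow> a = 0"
  by (simp add: l1_norm_def sum_nonneg_eq_0_iff vec_eq_iff)

text \<open>A small \<open>t\<close> does not change the sign of a nonzero \<open>a\<close>. The
  neighbourhood is two-sided, so that stationarity becomes an equation and not only an
  inequality.\<close>

lemma eventually_abs_add_mult:
  fixes a b :: real
  assumes "a = 0 \<Longrightarrow> b = 0"
  shows "\<forall>\<^sub>F t in nhds 0. \<bar>a + t * b\<bar> = \<bar>a\<bar> + t * (sgn a * b)"
proof -
  have lim: "((\<lambda>t. a + t * b) \<longlongrightarrow> a + 0 * b) (nhds 0)"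
    by (intro tendsto_intros filterlim_ident)
  consider "a = 0" | "a > 0" | "a < 0"
    by linarith
  then show ?thesis
  proof cases
    case 1
    then show ?thesis using assms by simp
  next
    case 2
    then have "\<forall>\<^sub>F t in nhds 0. 0 < a + t * b"
      using lim by (intro order_tendstoD) auto
    then show ?thesis
      by eventually_elim (use 2 in auto)
  next
    case 3
    then have "\<forall>\<^sub>F t in nhds 0. a + t * b < 0"
      using lim by (intro order_tendstoD) auto
    then show ?thesis
      by eventually_elim (use 3 in auto)
  qed
qed

lemma eventually_l1_norm_affine:
  fixes a b :: "real ^ 'm"
  assumes "\<And>i. a $ i = 0 \<Longrightarrow> b $ i = 0"
  shows "\<forall>\<^sub>F t in nhds 0. l1_norm (a + t *\<^sub>R b) = l1_norm a + t * (sign_vec a \<bullet> b)"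
proof -
  have "\<forall>\<^sub>F t in nhds 0. \<forall>i. \<bar>a $ i + t * b $ i\<bar> = \<bar>a $ i\<bar> + t * (sgn (a $ i) * b $ i)"
    by (intro eventually_all_finite eventually_abs_add_mult assms)
  then show ?thesis
    by eventually_elim
      (simp add: l1_norm_def sign_vec_def inner_vec_def sum.distrib sum_distrib_left)
qed

section \<open>Existence and optimality of solutions\<close>

lemma gen_lasso_solution_iff:
  "gen_lasso_solution y X D lam \<beta> \<longleftrightarrow>
     (\<forall>\<beta>'. gen_lasso_objective y X D lam \<beta> \<le> gen_lasso_objective y X D lam \<beta>')"
  by (auto simp: gen_lasso_solution_def is_arg_min_linorder)

text \<open>The objective is coercive because \<open>X\<close> and \<open>D\<close> together are
  injective, so the sublevel set \<open>K\<close> of its value at 0 is compact.\<close>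

lemma gen_lasso_solution_exists:
  fixes X :: "real ^ 'p ^ 'n" and D :: "real ^ 'p ^ 'm"
  assumes "lam > 0" and inj: "\<And>v. X *v v = 0 \<Longrightarrow> D *v v = 0 \<Longrightarrow> v = 0"
  shows "\<exists>\<beta>. gen_lasso_solution y X D lam \<beta>"
proof -
  let ?f = "gen_lasso_objective y X D lam"
  define K where "K = {\<beta>. ?f \<beta> \<le> ?f 0}"
  have cont: "continuous_on UNIV ?f"
    unfolding gen_lasso_objective_def l1_norm_def
    by (intro continuous_intros)
  have "linear (\<lambda>v. (X *v v, D *v v))"
    by (auto intro!: linearI simp: matrix_vector_right_distrib matrix_vector_mult_scaleR)
  moreover have "inj (\<lambda>v. (X *v v, D *v v))"
    using inj calculation by (subst linear_injective_0) (auto simp: zero_prod_def)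
  ultimately obtain c where c: "c > 0" "\<And>v. c * norm v \<le> norm (X *v v, D *v v)"
    using linear_inj_bounded_below_pos by blast
  define F where "F = ?f 0"
  \<comment> \<open>On \<open>K\<close> the residual has norm at most \<open>sqrt (2 * F)\<close>
    and the l1 norm is at most \<open>F / lam\<close>; \<open>c\<close> turns this into a bound on
    \<open>\<beta>\<close>.\<close>
  have "norm \<beta> \<le> (norm y + sqrt (2 * F) + F / lam) / c" if "\<beta> \<in> K" for \<beta>
  proof -
    have le: "1 / 2 * (norm (y - X *v \<beta>))\<^sup>2 + lam * l1_norm (D *v \<beta>) \<le> F"
      using that by (simp add: K_def F_def gen_lasso_objective_def)
    have "0 \<le> lam * l1_norm (D *v \<beta>)"
      using \<open>lam > 0\<close> by (simp add: l1_norm_nonneg)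
    then have "(norm (y - X *v \<beta>))\<^sup>2 \<le> 2 * F"
      using le by simp
    then have "norm (y - X *v \<beta>) \<le> sqrt (2 * F)"
      by (rule real_le_rsqrt)
    moreover have "norm (X *v \<beta>) \<le> norm y + norm (y - X *v \<beta>)"
      by (metis norm_triangle_sub norm_minus_commute add.commute)
    moreover have "lam * l1_norm (D *v \<beta>) \<le> F"
      using le by (smt (verit) zero_le_power2 divide_nonneg_nonneg mult_nonneg_nonneg)
    then have "l1_norm (D *v \<beta>) \<le> F / lam"
      using \<open>lam > 0\<close> by (simp add: pos_le_divide_eq mult.commute)
    moreover have "norm (D *v \<beta>) \<le> l1_norm (D *v \<beta>)"
      unfolding l1_norm_def by (rule norm_le_l1_cart)
    moreover have "c * norm \<beta> \<le> norm (X *v \<beta>) + norm (D *v \<beta>)"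
      using c(2) norm_Pair_le order_trans by blast
    ultimately have "c * norm \<beta> \<le> norm y + sqrt (2 * F) + F / lam"
      by linarith
    then show ?thesis
      using c(1) by (simp add: pos_le_divide_eq mult.commute)
  qed
  then have "bounded K"
    by (auto simp: bounded_iff)
  moreover have "closed K"
    unfolding K_def using cont by (intro closed_Collect_le) auto
  ultimately have "compact K"
    by (simp add: compact_eq_bounded_closed)
  moreover have "0 \<in> K"
    by (simp add: K_def)
  ultimately obtain \<beta> where \<beta>: "\<beta> \<in> K" "\<And>\<beta>'. \<beta>' \<in> K \<Longrightarrow> ?f \<beta> \<le> ?f \<beta>'"
    using continuous_attains_inf [of K ?f] continuous_on_subset [OF cont] by blast
  have "?f \<beta> \<le> ?f \<beta>'" for \<beta>'
    using \<beta>(2) [of \<beta>'] \<beta>(1) by (cases "\<beta>' \<in> K") (auto simp: K_def)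
  then show ?thesis
    by (auto simp: gen_lasso_solution_iff)
qed

text \<open>Near \<open>t = 0\<close> the objective at \<open>\<beta> + t *\<^sub>R u\<close> agrees
  with a quadratic polynomial \<open>g\<close>, whose derivative vanishes at its local minimum
  0.\<close>

lemma gen_lasso_stationary:
  assumes sol: "gen_lasso_solution y X D lam \<beta>"
    and "\<And>i. (D *v \<beta>) $ i = 0 \<Longrightarrow> (D *v u) $ i = 0"
  shows "(y - X *v \<beta>) \<bullet> (X *v u) = lam * (sign_vec (D *v \<beta>) \<bullet> (D *v u))"
proof -
  define r where "r = y - X *v \<beta>"
  define q where "q = X *v u"
  define c where "c = lam * (sign_vec (D *v \<beta>) \<bullet> (D *v u))"
  define L where "L = lam * l1_norm (D *v \<beta>)"
  define g where "g = (\<lambda>t. 1 / 2 * (r \<bullet> r - 2 * t * (r \<bullet> q) + t\<^sup>2 * (q \<bullet> q)) + (L + t * c))"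
  have "\<forall>\<^sub>F t in nhds 0. l1_norm (D *v \<beta> + t *\<^sub>R (D *v u)) =
      l1_norm (D *v \<beta>) + t * (sign_vec (D *v \<beta>) \<bullet> (D *v u))"
    using assms(2) by (rule eventually_l1_norm_affine)
  then have "\<forall>\<^sub>F t in nhds 0. g 0 \<le> g t"
  proof eventually_elim
    case (elim t)
    have "g t = gen_lasso_objective y X D lam (\<beta> + t *\<^sub>R u)"
    proof -
      have "y - X *v (\<beta> + t *\<^sub>R u) = r - t *\<^sub>R q"
        by (simp add: r_def q_def matrix_vector_right_distrib matrix_vector_mult_scaleR)
      moreover have "(norm (r - t *\<^sub>R q))\<^sup>2 = r \<bullet> r - 2 * t * (r \<bullet> q) + t\<^sup>2 * (q \<bullet> q)"
        unfolding power2_norm_eq_inner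
        by (simp add: inner_diff_left inner_diff_right inner_commute [of q r] power2_eq_square
            algebra_simps)
      moreover have "l1_norm (D *v (\<beta> + t *\<^sub>R u)) =
          l1_norm (D *v \<beta>) + t * (sign_vec (D *v \<beta>) \<bullet> (D *v u))"
        using elim by (simp add: matrix_vector_right_distrib matrix_vector_mult_scaleR)
      ultimately show ?thesis
        by (simp add: g_def gen_lasso_objective_def c_def L_def distrib_left)
    qed
    moreover have "g 0 = gen_lasso_objective y X D lam \<beta>"
      by (simp add: g_def gen_lasso_objective_def r_def L_def power2_norm_eq_inner)
    ultimately show ?case
      using sol by (simp add: gen_lasso_solution_iff)
  qed
  then obtain d where d: "d > 0" "\<And>t. dist t 0 < d \<Longrightarrow> g 0 \<le> g t"
    by (auto simp: eventually_nhds_metric)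
  have "(g has_field_derivative (c - r \<bullet> q)) (at 0)"
    unfolding g_def by (auto intro!: derivative_eq_intros)
  then have "c - r \<bullet> q = 0"
    using d by (intro DERIV_local_min [of g _ 0 d]) (auto simp: dist_real_def)
  then show ?thesis
    by (simp add: r_def q_def c_def)
qed

lemma gen_lasso_midpoint:
  fixes X :: "real ^ 'p ^ 'n" and D :: "real ^ 'p ^ 'm"
  assumes sol: "gen_lasso_solution y X D lam \<beta>1" "gen_lasso_solution y X D lam \<beta>2"
    and "lam > 0"
    and \<beta>: "\<beta> = (1 / 2) *\<^sub>R (\<beta>1 + \<beta>2)"
  shows "gen_lasso_solution y X D lam \<beta>"
    and "X *v \<beta>1 = X *v \<beta>2"
    and "(D *v \<beta>) $ i = 0 \<Longrightarrow> (D *v \<beta>1) $ i = 0 \<and> (D *v \<beta>2) $ i = 0"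
proof -
  let ?f = "gen_lasso_objective y X D lam"
  define a where "a = D *v \<beta>1"
  define b where "b = D *v \<beta>2"
  \<comment> \<open>The defects in the two convexity inequalities for the midpoint must both vanish.\<close>
  define e where "e i = \<bar>a $ i\<bar> + \<bar>b $ i\<bar> - \<bar>a $ i + b $ i\<bar>" for i
  have e_nonneg: "0 \<le> e i" for i
    by (simp add: e_def)
  have D\<beta>: "D *v \<beta> = (1 / 2) *\<^sub>R (a + b)"
    by (simp add: \<beta> a_def b_def matrix_vector_right_distrib matrix_vector_mult_scaleR scaleR_add_right)
  define r1 where "r1 = y - X *v \<beta>1"
  define r2 where "r2 = y - X *v \<beta>2"
  have "y - X *v \<beta> = (1 / 2) *\<^sub>R (r1 + r2)"
    by (simp add: \<beta> r1_def r2_def vec_eq_iff matrix_vector_right_distrib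
        matrix_vector_mult_scaleR field_simps)
  \<comment> \<open>The parallelogram law; its last term is the strict convexity of the squared
    error.\<close>
  moreover have "(norm ((1 / 2) *\<^sub>R (r1 + r2)))\<^sup>2 =
      1 / 2 * (norm r1)\<^sup>2 + 1 / 2 * (norm r2)\<^sup>2 - 1 / 4 * (norm (r1 - r2))\<^sup>2"
    unfolding power2_norm_eq_inner
    by (simp add: inner_diff_left inner_diff_right inner_add_left inner_add_right
        inner_commute [of r2 r1] field_simps)
  moreover have "norm (r1 - r2) = norm (X *v \<beta>1 - X *v \<beta>2)"
    by (simp add: r1_def r2_def norm_minus_commute)
  ultimately have fit: "(norm (y - X *v \<beta>))\<^sup>2 = 1 / 2 * (norm (y - X *v \<beta>1))\<^sup>2
      + 1 / 2 * (norm (y - X *v \<beta>2))\<^sup>2 - 1 / 4 * (norm (X *v \<beta>1 - X *v \<beta>2))\<^sup>2"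
    by (simp only: r1_def r2_def)
  have pen: "l1_norm (D *v \<beta>) = 1 / 2 * l1_norm a + 1 / 2 * l1_norm b - 1 / 2 * sum e UNIV"
    by (simp add: D\<beta> l1_norm_def e_def abs_mult sum.distrib sum_subtractf
        flip: sum_divide_distrib) (simp add: field_simps)
  have "?f \<beta> = 1 / 2 * ?f \<beta>1 + 1 / 2 * ?f \<beta>2
      - (1 / 8 * (norm (X *v \<beta>1 - X *v \<beta>2))\<^sup>2 + lam / 2 * sum e UNIV)"
    unfolding gen_lasso_objective_def fit pen a_def b_def by (simp add: field_simps)
  moreover have eq: "?f \<beta>1 = ?f \<beta>2"
    using sol by (auto simp: gen_lasso_solution_iff intro: antisym)
  moreover have le: "?f \<beta>1 \<le> ?f \<beta>"
    using sol by (simp add: gen_lasso_solution_iff)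
  moreover have "0 \<le> lam / 2 * sum e UNIV"
    using \<open>lam > 0\<close> e_nonneg by (simp add: sum_nonneg)
  moreover have "0 \<le> 1 / 8 * (norm (X *v \<beta>1 - X *v \<beta>2))\<^sup>2"
    by simp
  ultimately have zero: "1 / 8 * (norm (X *v \<beta>1 - X *v \<beta>2))\<^sup>2 = 0" "lam / 2 * sum e UNIV = 0"
      "?f \<beta> = ?f \<beta>1"
    by linarith+
  show "gen_lasso_solution y X D lam \<beta>"
    using zero(3) sol by (simp add: gen_lasso_solution_iff)
  show "X *v \<beta>1 = X *v \<beta>2"
    using zero(1) by simp
  have "e i = 0"
    using zero(2) \<open>lam > 0\<close> e_nonneg by (simp add: sum_nonneg_eq_0_iff)
  \<comment> \<open>A vanishing defect excludes cancellation in \<open>a $ i + b $ i\<close>, so a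
    zero sum forces both terms to be 0.\<close>
  then show "(D *v \<beta>1) $ i = 0 \<and> (D *v \<beta>2) $ i = 0" if "(D *v \<beta>) $ i = 0"
    using that unfolding D\<beta> e_def a_def [symmetric] b_def [symmetric] by auto
qed

section \<open>Faces and deterministic uniqueness\<close>

definition face :: "real ^ 'p ^ 'm \<Rightarrow> real ^ 'm \<Rightarrow> (real ^ 'p) set" where
  "face D s = {u. \<forall>i. s $ i = 0 \<longrightarrow> (D *v u) $ i = 0}"

text \<open>If \<open>s\<close> is the sign vector of \<open>D *v \<beta>\<close>, these are the
  directions in the face along which the penalty stays constant near \<open>\<beta>\<close>.\<close>

definition flat_face :: "real ^ 'p ^ 'm \<Rightarrow> real ^ 'm \<Rightarrow> (real ^ 'p) set" where
  "flat_face D s = face D s \<inter> {u. s \<bullet> (D *v u) = 0}"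

lemma subspace_face: "subspace (face D s)"
  by (auto simp: face_def subspace_def matrix_vector_right_distrib matrix_vector_mult_scaleR)

lemma subspace_flat_face: "subspace (flat_face D s)"
  by (auto simp: flat_face_def face_def subspace_def matrix_vector_right_distrib
      matrix_vector_mult_scaleR inner_add_right)

text \<open>The flat face is cut out of the face by a single linear functional, so at most one
  dimension is lost.\<close>

lemma dim_face_le_dim_flat_face:
  fixes D :: "real ^ 'p ^ 'm"
  shows "dim (face D s) \<le> Suc (dim (flat_face D s))"
proof -
  let ?H = "{u. (s v* D) \<bullet> u = 0}"
  have flat_eq: "flat_face D s = face D s \<inter> ?H"
    by (simp add: flat_face_def dot_lmul_matrix)
  \<comment> \<open>\<open>?H\<close> is the whole space if the functional is zero and a hyperplane
    otherwise.\<close>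
  have "CARD('p) \<le> Suc (dim ?H)"
    by (cases "s v* D = 0") (auto simp: dim_hyperplane)
  moreover have "dim {x + y |x y. x \<in> face D s \<and> y \<in> ?H} \<le> CARD('p)"
    by (rule dim_subset_UNIV_cart)
  moreover have "dim {x + y |x y. x \<in> face D s \<and> y \<in> ?H} + dim (face D s \<inter> ?H) =
      dim (face D s) + dim ?H"
    by (intro dim_sums_Int subspace_face subspace_hyperplane)
  ultimately show ?thesis
    unfolding flat_eq by linarith
qed

lemma gen_lasso_solution_unique:
  fixes X :: "real ^ 'p ^ 'n" and D :: "real ^ 'p ^ 'm"
  assumes "lam > 0"
    and gp: "\<And>a. general_position X (face D (sign_vec a))"
      "\<And>a. general_position X (flat_face D (sign_vec a))"
    and inj: "\<And>v. X *v v = 0 \<Longrightarrow> D *v v = 0 \<Longrightarrow> v = 0"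
    and sol: "gen_lasso_solution y X D lam \<beta>1" "gen_lasso_solution y X D lam \<beta>2"
  shows "\<beta>1 = \<beta>2"
proof (rule ccontr)
  assume "\<beta>1 \<noteq> \<beta>2"
  define \<beta> where "\<beta> = (1 / 2) *\<^sub>R (\<beta>1 + \<beta>2)"
  define s where "s = sign_vec (D *v \<beta>)"
  define r where "r = y - X *v \<beta>"
  note mid = gen_lasso_midpoint [OF sol \<open>lam > 0\<close> \<beta>_def]
  have s0: "s $ i = 0 \<longleftrightarrow> (D *v \<beta>) $ i = 0" for i
    by (simp add: s_def sign_vec_def sgn_0_0)
  have X0: "X *v (\<beta>1 - \<beta>2) = 0"
    using mid(2) by (simp add: matrix_vector_mult_diff_distrib)
  have "\<beta>1 - \<beta>2 \<in> face D s"
    using mid(3) by (simp add: face_def s0 matrix_vector_mult_diff_distrib)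
  then have big: "CARD('n) < dim (face D s)"
    using gp(1) [of "D *v \<beta>"] X0 \<open>\<beta>1 \<noteq> \<beta>2\<close>
    by (fastforce simp: general_position_def s_def not_le [symmetric])
  then have onto: "(*v) X ` face D s = UNIV"
    using gp(1) [of "D *v \<beta>"] by (simp add: general_position_def s_def)
  \<comment> \<open>The strict inequality \<open>big\<close> absorbs the one dimension that may be
    lost.\<close>
  have "CARD('n) \<le> dim (flat_face D s)"
    using big dim_face_le_dim_flat_face [of D s] by linarith
  then have onto': "(*v) X ` flat_face D s = UNIV"
    using gp(2) [of "D *v \<beta>"] by (simp add: general_position_def s_def)
  have stat: "r \<bullet> (X *v u) = lam * (s \<bullet> (D *v u))" if "u \<in> face D s" for u
    unfolding r_def s_def
    using that s0 by (intro gen_lasso_stationary mid(1)) (auto simp: face_def)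
  \<comment> \<open>A flat direction \<open>w\<close> with the same image under \<open>X\<close> has
    the same left-hand side in \<open>stat\<close>, and its right-hand side is 0.\<close>
  have flat_orth: "s \<bullet> (D *v u) = 0" if "u \<in> face D s" for u
  proof -
    obtain w where w: "w \<in> flat_face D s" "X *v w = X *v u"
      using onto' by (metis UNIV_I imageE)
    then show ?thesis
      using stat [of w] stat [OF that] \<open>lam > 0\<close> by (simp add: flat_face_def)
  qed
  \<comment> \<open>Testing \<open>stat\<close> in a direction that \<open>X\<close> maps to the
    residual itself gives \<open>r \<bullet> r = 0\<close>.\<close>
  obtain u where "u \<in> face D s" "X *v u = r"
    using onto by (metis UNIV_I imageE)
  then have "r = 0"
    using stat flat_orth by (metis inner_eq_zero_iff mult_zero_right)
  moreover have "\<beta> \<in> face D s"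
    by (simp add: face_def s0)
  then have "l1_norm (D *v \<beta>) = 0"
    using flat_orth by (metis s_def inner_sign_vec_self)
  ultimately have "D *v \<beta> = 0"
    by (simp add: l1_norm_eq_0_iff)
  then have "D *v (\<beta>1 - \<beta>2) = 0"
    using mid(3) by (simp add: vec_eq_iff matrix_vector_mult_diff_distrib)
  then show False
    using inj X0 \<open>\<beta>1 \<noteq> \<beta>2\<close> by force
qed

section \<open>Almost sure uniqueness\<close>

text \<open>The conditions of general position concern \<open>X\<close> alone, so one null set of
  matrices serves all \<open>y\<close> at once.\<close>

lemma AE_unique_gen_lasso_solution:
  fixes D :: "real ^ 'p ^ 'm"
  assumes "lam > 0" and null: "nullity D \<le> CARD('n)"
  shows "AE X :: real ^ 'p ^ 'n in lborel. \<forall>y. \<exists>!\<beta>. gen_lasso_solution y X D lam \<beta>"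
proof -
  have "subspace {\<beta>. D *v \<beta> = 0}"
    by (simp add: subspace_def matrix_vector_right_distrib matrix_vector_mult_scaleR)
  then have "AE X :: real ^ 'p ^ 'n in lborel. general_position X {\<beta>. D *v \<beta> = 0}"
    by (rule AE_general_position)
  moreover have "AE X :: real ^ 'p ^ 'n in lborel. \<forall>s\<in>range sign_vec.
      general_position X (face D s) \<and> general_position X (flat_face D s)"
    by (intro AE_finite_allI finite_range_sign_vec AE_conjI AE_general_position
        subspace_face subspace_flat_face)
  ultimately show ?thesis
  proof eventually_elim
    case (elim X)
    have inj: "v = 0" if "X *v v = 0" "D *v v = 0" for v
      using elim(1) null that by (simp add: general_position_def nullity_def)
    have "\<beta>1 = \<beta>2"
      if "gen_lasso_solution y X D lam \<beta>1" "gen_lasso_solution y X D lam \<beta>2" for y \<beta>1 \<beta>2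
      using \<open>lam > 0\<close> _ _ inj that by (rule gen_lasso_solution_unique) (use elim(2) in auto)
    moreover have "\<exists>\<beta>. gen_lasso_solution y X D lam \<beta>" for y
      using \<open>lam > 0\<close> inj by (rule gen_lasso_solution_exists)
    ultimately show ?case
      by (intro allI ex_ex1I) auto
  qed
qed

lemma AE_fst_lborel:
  assumes "AE x in (lborel :: 'a::euclidean_space measure). P x"
  shows "AE z in (lborel :: ('a \<times> 'b::euclidean_space) measure). P (fst z)"
proof -
  obtain N where N: "N \<in> null_sets lborel" "{x. \<not> P x} \<subseteq> N"
    using assms by (auto simp: eventually_ae_filter)
  have "N \<times> UNIV \<in> null_sets (lborel \<Otimes>\<^sub>M (lborel :: 'b measure))"
    using N(1) by (intro lborel.times_in_null_sets1) auto
  then have "N \<times> UNIV \<in> null_sets (lborel :: ('a \<times> 'b) measure)"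
    by (simp add: lborel_prod)
  then show ?thesis
    by (rule AE_I') (use N(2) in auto)
qed

theorem theorem1:
  fixes M :: "'w measure"
    and X :: "'w \<Rightarrow> real ^ 'p ^ 'n"
    and y :: "'w \<Rightarrow> real ^ 'n"
    and D :: "real ^ 'p ^ 'm"
    and lam :: real
  assumes "prob_space M"
    and "X \<in> borel_measurable M"
    and "y \<in> borel_measurable M"
    and "absolutely_continuous lborel (distr M borel (\<lambda>\<omega>. (X \<omega>, y \<omega>)))"
    and "lam > 0"
    and "CARD('p) \<le> CARD('n) \<or> (CARD('p) > CARD('n) \<and> nullity D \<le> CARD('n))"
  shows "AE \<omega> in M. \<exists>!\<beta>. gen_lasso_solution (y \<omega>) (X \<omega>) D lam \<beta>"
proof -
  \<comment> \<open>This merges the two alternatives of the hypothesis into the single bound by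
    \<open>CARD('n)\<close>.\<close>
  have "nullity D \<le> CARD('p)"
    unfolding nullity_def by (rule dim_subset_UNIV_cart)
  then have "nullity D \<le> CARD('n)"
    using assms(6) by linarith
  then have "AE X :: real ^ 'p ^ 'n in lborel. \<forall>y. \<exists>!\<beta>. gen_lasso_solution y X D lam \<beta>"
    using \<open>lam > 0\<close> by (intro AE_unique_gen_lasso_solution)
  then have "AE z :: (real ^ 'p ^ 'n) \<times> (real ^ 'n) in lborel.
      \<forall>y. \<exists>!\<beta>. gen_lasso_solution y (fst z) D lam \<beta>"
    by (rule AE_fst_lborel)
  \<comment> \<open>Absolute continuity transfers the null set from Lebesgue measure to the joint
    law.\<close>
  then have "AE z in distr M borel (\<lambda>\<omega>. (X \<omega>, y \<omega>)).
      \<forall>y. \<exists>!\<beta>. gen_lasso_solution y (fst z) D lam \<beta>"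
    by (rule absolutely_continuous_AE [OF _ assms(4), rotated]) simp
  moreover have "(\<lambda>\<omega>. (X \<omega>, y \<omega>)) \<in> M \<rightarrow>\<^sub>M borel"
    using assms(2,3) by (rule borel_measurable_Pair)
  ultimately have "AE \<omega> in M. \<forall>y'. \<exists>!\<beta>. gen_lasso_solution y' (fst (X \<omega>, y \<omega>)) D lam \<beta>"
    by (rule AE_distrD [rotated])
  then show ?thesis
    by (rule eventually_mono) (simp only: fst_conv)
qed

end
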